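(* Let $n\ge1$, $0<\alpha<2$, and let $G\in C^1(\mathbb{R})$ satisfy $G(0)=0$ and $G'(t)\ge c_0>0$ for all $t\in\mathbb{R}$. Let $f:\mathbb{R}\to\mathbb{R}$ be Lipschitz continuous. Assume that $u\in L_\alpha\cap C^{1,1}_{loc}(B_1(0))$ is a positive solution of $$\begin{cases}F_\alpha(u(x))=f(u(x)), & x\in B_1(0),\\ u(x)=0, & x\notin B_1(0),\end{cases}$$ where positive means $u>0$ in $B_1(0)$. Then $u$ must be radially symmetric and monotone decreasing about the origin.
   Context: $B_1(0)$ is the open unit ball of $\mathbb{R}^n$. For $0<\alpha<2$, $$F_\alpha(u(x)) = C_{n,\alpha}\lim_{\epsilon\to0}\int_{\mathbb{R}^n\setminus B_\epsilon(x)}\frac{G(u(x)-u(z))}{|x-z|^{n+\alpha}}\,dz,$$ where $C_{n,\alpha}>0$ is a constant depending only on $n$ and $\alpha$; the equation presupposes that this limit exists and is finite at each $x\in B_1(0)$. The space $L_\alpha$ is $$L_\alpha=\Big\{u\in L^1_{loc}(\mathbb{R}^n)\ :\ \int_{\mathbb{R}^n}\frac{|u(x)|}{1+|x|^{n+\alpha}}\,dx<\infty\Big\}.$$ "Radially symmetric and monotone decreasing about the origin" means that $u(x)$ depends only on $|x|$ and is decreasing as a function of $|x|$ in $B_1(0)$.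
   Formalization: The solution u is additionally assumed continuous on the closed unit ball; without this the claim fails, e.g. for G(t)=t, f=0, u(x)=(1-|x|^2)^{α/2-1} in the ball and 0 outside, which is increasing in |x|. *)

theory Defs
  imports "HOL-Analysis.Analysis"
begin

definition L_space :: "real \<Rightarrow> (real ^ 'n \<Rightarrow> real) set" where
  "L_space \<alpha> = {u. (\<forall>K. compact K \<longrightarrow> set_integrable lebesgue K u) \<and>
     integrable lebesgue (\<lambda>x. \<bar>u x\<bar> / (1 + norm x powr (real CARD('n) + \<alpha>)))}"

(* Lipschitz continuity of the gradient on every compact subset of the open set S
   is the same as local Lipschitz continuity on S. *)
definition C11_loc :: "(real ^ 'n) set \<Rightarrow> (real ^ 'n \<Rightarrow> real) set" where
  "C11_loc S = {u. \<exists>Du. (\<forall>x\<in>S. GDERIV u x :> Du x) \<and>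
     (\<forall>K. compact K \<and> K \<subseteq> S \<longrightarrow> (\<exists>L. L-lipschitz_on K Du))}"

definition F_integrand ::
  "real \<Rightarrow> (real \<Rightarrow> real) \<Rightarrow> (real ^ 'n \<Rightarrow> real) \<Rightarrow> real ^ 'n \<Rightarrow> real ^ 'n \<Rightarrow> real" where
  "F_integrand \<alpha> G u x z = G (u x - u z) / norm (x - z) powr (real CARD('n) + \<alpha>)"

definition F_truncated ::
  "real \<Rightarrow> (real \<Rightarrow> real) \<Rightarrow> (real ^ 'n \<Rightarrow> real) \<Rightarrow> real ^ 'n \<Rightarrow> real \<Rightarrow> real" where
  "F_truncated \<alpha> G u x \<epsilon> = set_lebesgue_integral lebesgue (- ball x \<epsilon>) (F_integrand \<alpha> G u x)"

(* The truncated integrals converge absolutely and their limit exists and is finite.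
   Only under this condition is the value F_op meaningful: Bochner integrals of
   non-integrable functions are 0 and Lim of a divergent function is arbitrary. *)
definition F_exists ::
  "real \<Rightarrow> (real \<Rightarrow> real) \<Rightarrow> (real ^ 'n \<Rightarrow> real) \<Rightarrow> real ^ 'n \<Rightarrow> bool" where
  "F_exists \<alpha> G u x \<longleftrightarrow>
     (\<forall>\<epsilon>>0. set_integrable lebesgue (- ball x \<epsilon>) (F_integrand \<alpha> G u x)) \<and>
     (\<exists>l. (F_truncated \<alpha> G u x \<longlongrightarrow> l) (at_right 0))"

(* C plays the role of the normalising constant C_{n,alpha}. *)
definition F_op ::
  "real \<Rightarrow> real \<Rightarrow> (real \<Rightarrow> real) \<Rightarrow> (real ^ 'n \<Rightarrow> real) \<Rightarrow> real ^ 'n \<Rightarrow> real" where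
  "F_op C \<alpha> G u x = C * Lim (at_right 0) (F_truncated \<alpha> G u x)"

definition radial_decreasing :: "(real ^ 'n \<Rightarrow> real) \<Rightarrow> bool" where
  "radial_decreasing u \<longleftrightarrow>
     (\<exists>g. (\<forall>x. u x = g (norm x)) \<and> strict_antimono_on {0..<1} g)"

end

theory Submission
  imports Defs
begin

text \<open>
  Moving planes. Reflect \<open>u\<close> in the hyperplane \<open>x \<bullet> e = l\<close> with \<open>l < 0\<close> and let \<open>w\<close> be the reflected
  function minus \<open>u\<close>. At a nonpositive minimum \<open>x\<close> of \<open>w\<close> over the half-space \<open>x \<bullet> e < l\<close>, subtracting the
  equations at \<open>x\<close> and at its reflection bounds \<open>f (u x + w x) - f (u x)\<close> above by a quantity that is
  negative unless \<open>w\<close> vanishes on the half-space, because \<open>G' \<ge> c0\<close>. If \<open>w x < 0\<close> and the distance of \<open>x\<close> to the hyperplane is \<open>\<delta>\<close>, the bound is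
  of order \<open>w x / \<delta> powr \<alpha>\<close>, so the Lipschitz property of \<open>f\<close> keeps \<open>\<delta>\<close> away from 0. If \<open>w x = 0\<close>, it
  contradicts \<open>f (u x + w x) = f (u x)\<close>. Together these facts prevent the plane from stopping before it reaches the origin.
\<close>

section \<open>Invariance of Lebesgue measure under translations and orthogonal maps\<close>

lemma nn_integral_lborel_translate:
  fixes f :: "'a::euclidean_space \<Rightarrow> ennreal"
  assumes [measurable]: "f \<in> borel_measurable borel"
  shows "(\<integral>\<^sup>+x. f (x + c) \<partial>lborel) = (\<integral>\<^sup>+x. f x \<partial>lborel)"
proof -
  have "(\<integral>\<^sup>+x. f x \<partial>lborel) = (\<integral>\<^sup>+x. f x \<partial>distr lborel borel ((+) c))"
    by (simp only: lborel_distr_plus)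
  also have "\<dots> = (\<integral>\<^sup>+x. f (c + x) \<partial>lborel)"
    by (subst nn_integral_distr) auto
  finally show ?thesis
    by (simp add: add.commute)
qed

text \<open>The library's invariance of Lebesgue measure under linear maps needs a well-ordered index type.
  Here it comes from translation invariance: integrate \<open>indicator A x * indicator B (x + T y)\<close>, with
  \<open>B\<close> the unit ball, in both orders.\<close>
lemma emeasure_lborel_orthogonal:
  fixes T :: "'a::euclidean_space \<Rightarrow> 'a"
  assumes T: "orthogonal_transformation T" and A: "A \<in> sets borel"
  shows "emeasure lborel {x. - T x \<in> A} = emeasure lborel A"
proof -
  let ?B = "ball 0 1 :: 'a set"
  have lin: "linear T"
    using T by (simp add: orthogonal_transformation_def)
  have norm_T: "norm (T x) = norm x" for x
    using T by (simp add: orthogonal_transformation_norm)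
  have T_meas[measurable]: "T \<in> borel_measurable borel"
    using lin by (intro borel_measurable_continuous_onI linear_continuous_on) (simp add: linear_linear)
  note [measurable] = A borel_open[OF open_ball[of "0::'a" 1]]
  have set_A[measurable]: "{x. - T x \<in> A} \<in> sets borel"
    by measurable
  have "emeasure lborel A * emeasure lborel ?B
      = (\<integral>\<^sup>+x. indicator A x * (\<integral>\<^sup>+y. indicator ?B y \<partial>lborel) \<partial>lborel)"
    by (simp add: nn_integral_multc)
  also have "\<dots> = (\<integral>\<^sup>+x. indicator A x * (\<integral>\<^sup>+y. indicator ?B (x + T y) \<partial>lborel) \<partial>lborel)"
  proof (rule nn_integral_cong)
    fix x :: 'a
    \<comment> \<open>As \<open>T\<close> is onto and preserves norms,
      \<open>x + T y = T (y + v)\<close> lies in the ball exactly when \<open>y + v\<close> does, so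
      the inner integral is the volume of the ball whatever \<open>x\<close> is.\<close>
    obtain v where v: "x = T v"
      using orthogonal_transformation_surj[OF T] by (metis surjD)
    have "(\<integral>\<^sup>+y. indicator ?B (x + T y) \<partial>lborel) = (\<integral>\<^sup>+y. indicator ?B (y + v) \<partial>lborel)"
    proof (rule nn_integral_cong)
      fix y
      have "x + T y = T (y + v)"
        using lin by (simp add: v linear_add)
      then show "indicator ?B (x + T y) = (indicator ?B (y + v) :: ennreal)"
        by (simp add: indicator_def norm_T)
    qed
    also have "\<dots> = (\<integral>\<^sup>+y. indicator ?B y \<partial>lborel)"
      by (rule nn_integral_lborel_translate) measurable
    finally show "indicator A x * (\<integral>\<^sup>+y. indicator ?B y \<partial>lborel)
        = indicator A x * (\<integral>\<^sup>+y. indicator ?B (x + T y) \<partial>lborel)"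
      by simp
  qed
  also have "\<dots> = (\<integral>\<^sup>+x. (\<integral>\<^sup>+y. indicator A x * indicator ?B (x + T y) \<partial>lborel) \<partial>lborel)"
    by (intro nn_integral_cong nn_integral_cmult[symmetric]) measurable
  also have "\<dots> = (\<integral>\<^sup>+y. (\<integral>\<^sup>+x. indicator A x * indicator ?B (x + T y) \<partial>lborel) \<partial>lborel)"
    by (rule lborel_pair.Fubini') measurable
  also have "\<dots> = (\<integral>\<^sup>+y. (\<integral>\<^sup>+x. indicator A (x - T y) * indicator ?B x \<partial>lborel) \<partial>lborel)"
  proof (rule nn_integral_cong)
    fix y :: 'a
    have "(\<integral>\<^sup>+x. indicator A (x - T y) * indicator ?B x \<partial>lborel)
      = (\<integral>\<^sup>+x. indicator A ((x + T y) - T y) * indicator ?B (x + T y) \<partial>lborel)"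
      by (rule nn_integral_lborel_translate[symmetric]) measurable
    then show "(\<integral>\<^sup>+x. indicator A x * indicator ?B (x + T y) \<partial>lborel)
        = (\<integral>\<^sup>+x. indicator A (x - T y) * indicator ?B x \<partial>lborel)"
      by simp
  qed
  also have "\<dots> = (\<integral>\<^sup>+x. (\<integral>\<^sup>+y. indicator A (x - T y) * indicator ?B x \<partial>lborel) \<partial>lborel)"
    by (rule lborel_pair.Fubini'[symmetric]) measurable
  also have "\<dots> = (\<integral>\<^sup>+x. (\<integral>\<^sup>+y. indicator A (x - T y) \<partial>lborel) * indicator ?B x \<partial>lborel)"
    by (intro nn_integral_cong nn_integral_multc) measurable
  also have "\<dots> = (\<integral>\<^sup>+x. emeasure lborel {x. - T x \<in> A} * indicator ?B x \<partial>lborel)"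
  proof (rule nn_integral_cong)
    fix x :: 'a
    \<comment> \<open>Shifting \<open>y\<close> by \<open>v\<close> absorbs \<open>x\<close>,
      because \<open>x - T (y + v) = - T y\<close>.\<close>
    obtain v where v: "x = T v"
      using orthogonal_transformation_surj[OF T] by (metis surjD)
    have "(\<integral>\<^sup>+y. indicator A (x - T y) \<partial>lborel) = (\<integral>\<^sup>+y. indicator A (x - T (y + v)) \<partial>lborel)"
      by (rule nn_integral_lborel_translate[symmetric]) measurable
    also have "\<dots> = (\<integral>\<^sup>+y. indicator {x. - T x \<in> A} y \<partial>lborel)"
      by (intro nn_integral_cong) (simp add: v linear_add[OF lin] indicator_def)
    also have "\<dots> = emeasure lborel {x. - T x \<in> A}"
      by simp
    finally show "(\<integral>\<^sup>+y. indicator A (x - T y) \<partial>lborel) * indicator ?B x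
        = emeasure lborel {x. - T x \<in> A} * indicator ?B x"
      by simp
  qed
  also have "\<dots> = emeasure lborel {x. - T x \<in> A} * emeasure lborel ?B"
    by (simp add: nn_integral_cmult)
  finally have "emeasure lborel A * emeasure lborel ?B = emeasure lborel {x. - T x \<in> A} * emeasure lborel ?B" .
  moreover have "emeasure lborel ?B \<noteq> 0" "emeasure lborel ?B \<noteq> \<infinity>"
    using content_ball_pos[of 1 "0::'a"] emeasure_lborel_ball_finite[of "0::'a" 1]
    by (auto simp: measure_def)
  ultimately show ?thesis
    by (metis ennreal_mult_divide_eq infinity_ennreal_def)
qed

section \<open>Reflection in a hyperplane with unit normal\<close>

definition reflect :: "'a::real_inner \<Rightarrow> real \<Rightarrow> 'a \<Rightarrow> 'a" where
  "reflect e l x = x + (2 * (l - x \<bullet> e)) *\<^sub>R e"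

lemma continuous_on_reflect [continuous_intros]:
  "continuous_on S f \<Longrightarrow> continuous_on S (\<lambda>x. reflect e l (f x))"
  unfolding reflect_def by (intro continuous_intros)

lemma reflect_measurable [measurable]: "reflect e l \<in> borel_measurable borel"
  by (intro borel_measurable_continuous_onI continuous_intros)

context
  fixes e :: "'a::real_inner"
  assumes unit: "norm e = 1"
begin

lemma inner_unit: "e \<bullet> e = 1"
  using unit by (simp add: dot_square_norm)

lemma reflect_inner: "reflect e l x \<bullet> e = 2 * l - x \<bullet> e"
  by (simp add: reflect_def inner_add_left inner_unit)

lemma reflect_reflect [simp]: "reflect e l (reflect e l x) = x"
proof -
  have "reflect e l (reflect e l x) = x + (2 * (l - x \<bullet> e) + 2 * (l - (2 * l - x \<bullet> e))) *\<^sub>R e"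
    unfolding reflect_def[of e l "reflect e l x"] reflect_inner
    by (simp only: reflect_def add.assoc scaleR_add_left)
  then show ?thesis
    by simp
qed

text \<open>The added term is a product of signed distances to the plane: for points strictly on the
  same side, reflecting one of them increases their distance. With \<open>x = 0\<close> the formula
  tells how reflection changes the norm.\<close>

lemma norm_reflect_diff_sq:
  "(norm (x - reflect e l z))\<^sup>2 = (norm (x - z))\<^sup>2 + 4 * (l - x \<bullet> e) * (l - z \<bullet> e)"
proof -
  define t where "t = 2 * (l - z \<bullet> e)"
  have "(norm (x - reflect e l z))\<^sup>2 = ((x - z) - t *\<^sub>R e) \<bullet> ((x - z) - t *\<^sub>R e)"
    by (simp add: power2_norm_eq_inner reflect_def t_def diff_diff_eq)
  also have "\<dots> = (x - z) \<bullet> (x - z) - 2 * t * ((x - z) \<bullet> e) + t * t"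
    by (simp only: inner_diff_left[of "x - z" "t *\<^sub>R e"] inner_diff_right[of _ "x - z" "t *\<^sub>R e"]
        inner_scaleR_left inner_scaleR_right inner_unit inner_commute[of e "x - z"])
      (simp add: right_diff_distrib)
  also have "\<dots> = (norm (x - z))\<^sup>2 + t * (t - 2 * (x \<bullet> e - z \<bullet> e))"
    by (simp add: power2_norm_eq_inner inner_diff_left[of x z e] right_diff_distrib)
  also have "t - 2 * (x \<bullet> e - z \<bullet> e) = 2 * (l - x \<bullet> e)"
    by (simp add: t_def)
  also have "t * (2 * (l - x \<bullet> e)) = 4 * (l - x \<bullet> e) * (l - z \<bullet> e)"
    unfolding t_def by algebra
  finally show ?thesis .
qed

lemma norm_reflect_sq: "(norm (reflect e l x))\<^sup>2 = (norm x)\<^sup>2 + 4 * l * (l - x \<bullet> e)"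
  using norm_reflect_diff_sq[of 0 l x] by simp

lemma norm_reflect_reflect: "norm (reflect e l x - reflect e l z) = norm (x - z)"
proof -
  have "(norm (reflect e l x - reflect e l z))\<^sup>2
      = (norm (z - x))\<^sup>2 + 4 * (l - z \<bullet> e) * (l - x \<bullet> e) + 4 * (l - (2 * l - x \<bullet> e)) * (l - z \<bullet> e)"
    using norm_reflect_diff_sq[of "reflect e l x" l z] norm_reflect_diff_sq[of z l x]
    by (simp add: reflect_inner norm_minus_commute)
  also have "\<dots> = (norm (x - z))\<^sup>2"
    by (simp add: norm_minus_commute algebra_simps)
  finally show ?thesis
    by simp
qed

lemma norm_reflect_commute: "norm (reflect e l x - z) = norm (x - reflect e l z)"
  using norm_reflect_reflect[of l x "reflect e l z"] by simp

end

section \<open>Lebesgue integrals under reflection\<close>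

lemma distr_reflect:
  fixes e :: "'a::euclidean_space"
  assumes unit: "norm e = 1"
  shows "distr lborel borel (reflect e l) = lborel"
proof (rule measure_eqI)
  fix A assume "A \<in> sets (distr lborel borel (reflect e l))"
  then have A[measurable]: "A \<in> sets borel" by simp
  \<comment> \<open>The sign matches \<open>emeasure_lborel_orthogonal\<close>, which is about
    \<open>- T x\<close>. A general reflection is \<open>- T\<close> followed by the translation by
    \<open>2 * l\<close> along \<open>e\<close>.\<close>
  define T where "T x = - reflect e 0 x" for x
  have "orthogonal_transformation T"
    unfolding orthogonal_transformation_def
  proof
    show "linear T"
      by (rule linearI) (simp_all add: T_def reflect_def algebra_simps inner_simps)
    show "\<forall>v w. T v \<bullet> T w = v \<bullet> w"
    proof (intro allI)
      fix v w
      show "T v \<bullet> T w = v \<bullet> w"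
        using inner_commute[of e v] inner_commute[of e w]
        by (simp add: T_def reflect_def inner_simps inner_unit[OF unit])
    qed
  qed
  have T: "reflect e l x = - T x + (2 * l) *\<^sub>R e" for x
    by (simp add: T_def reflect_def algebra_simps)
  have "emeasure (distr lborel borel (reflect e l)) A = emeasure lborel {x. - T x \<in> {y. y + (2 * l) *\<^sub>R e \<in> A}}"
    by (subst emeasure_distr) (auto simp: T vimage_def)
  also have "\<dots> = emeasure lborel {y. y + (2 * l) *\<^sub>R e \<in> A}"
    by (rule emeasure_lborel_orthogonal) (fact, measurable)
  also have "\<dots> = (\<integral>\<^sup>+x. indicator A (x + (2 * l) *\<^sub>R e) \<partial>lborel)"
  proof -
    have "{y. y + (2 * l) *\<^sub>R e \<in> A} \<in> sets lborel"
      by measurable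
    from nn_integral_indicator[OF this, symmetric] show ?thesis
      by (simp add: indicator_def)
  qed
  also have "\<dots> = emeasure lborel A"
    by (subst nn_integral_lborel_translate) auto
  finally show "emeasure (distr lborel borel (reflect e l)) A = emeasure lborel A" .
qed simp

lemma
  fixes e :: "'a::euclidean_space" and f :: "'a \<Rightarrow> real"
  assumes unit: "norm e = 1" and f: "f \<in> borel_measurable borel"
  shows integral_reflect: "(\<integral>x. f (reflect e l x) \<partial>lborel) = (\<integral>x. f x \<partial>lborel)"
    and integrable_reflect: "integrable lborel (\<lambda>x. f (reflect e l x)) \<longleftrightarrow> integrable lborel f"
  using integral_distr[of "reflect e l" lborel borel f] integrable_distr_eq[of "reflect e l" lborel borel f] f
  by (simp_all add: distr_reflect[OF unit])

text \<open>The hyperplane itself is null, so the integral folds onto one side.\<close>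
lemma integral_fold_reflect:
  fixes e :: "'a::euclidean_space" and h :: "'a \<Rightarrow> real" and l :: real
  assumes unit: "norm e = 1" and h: "integrable lborel h"
  defines "H \<equiv> {z. z \<bullet> e < l}"
  shows "integrable lborel (\<lambda>z. indicator H z * (h z + h (reflect e l z)))"
    and "(\<integral>z. h z \<partial>lborel) = (\<integral>z. indicator H z * (h z + h (reflect e l z)) \<partial>lborel)"
proof -
  have H[measurable]: "H \<in> sets borel"
    unfolding H_def by measurable
  have [measurable]: "h \<in> borel_measurable borel"
    using h by auto
  have hR: "integrable lborel (\<lambda>z. h (reflect e l z))"
    using h by (subst integrable_reflect[OF unit]) auto
  have int1: "integrable lborel (\<lambda>z. indicator H z * h z)"
    using h integrable_mult_indicator[of H lborel h] by simp
  have int2: "integrable lborel (\<lambda>z. indicator H z * h (reflect e l z))"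
    using hR integrable_mult_indicator[of H lborel "\<lambda>z. h (reflect e l z)"] by simp
  have int3: "integrable lborel (\<lambda>z. indicator (-H) z * h z)"
    using h integrable_mult_indicator[of "-H" lborel h] by simp
  show "integrable lborel (\<lambda>z. indicator H z * (h z + h (reflect e l z)))"
    using int1 int2 by (simp add: distrib_left)
  have "{z. e \<bullet> z = l} \<in> null_sets lebesgue"
    using negligible_hyperplane[of e l] unit by (metis negligible_iff_null_sets norm_zero zero_neq_one)
  from AE_not_in[OF this] have "AE z in lebesgue. z \<bullet> e \<noteq> l"
    by (simp add: inner_commute)
  then have ae: "AE z in lborel. z \<bullet> e \<noteq> l"
    by (simp add: AE_completion_iff)
  have "(\<integral>z. indicator (-H) z * h z \<partial>lborel) = (\<integral>z. indicator (-H) (reflect e l z) * h (reflect e l z) \<partial>lborel)"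
    by (rule integral_reflect[OF unit, symmetric]) measurable
  also have "\<dots> = (\<integral>z. indicator H z * h (reflect e l z) \<partial>lborel)"
  proof (rule integral_cong_AE)
    show "AE z in lborel. indicator (- H) (reflect e l z) * h (reflect e l z) = indicator H z * h (reflect e l z)"
      using ae by eventually_elim (simp add: H_def indicator_def reflect_inner[OF unit])
  qed measurable
  finally have fold: "(\<integral>z. indicator (-H) z * h z \<partial>lborel) = (\<integral>z. indicator H z * h (reflect e l z) \<partial>lborel)" .
  have "(\<integral>z. h z \<partial>lborel) = (\<integral>z. indicator H z * h z + indicator (-H) z * h z \<partial>lborel)"
    by (intro Bochner_Integration.integral_cong) (auto simp: indicator_def)
  also have "\<dots> = (\<integral>z. indicator H z * h z \<partial>lborel) + (\<integral>z. indicator H z * h (reflect e l z) \<partial>lborel)"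
    using int1 int3 by (simp add: fold)
  also have "\<dots> = (\<integral>z. indicator H z * (h z + h (reflect e l z)) \<partial>lborel)"
    using int1 int2 by (simp add: distrib_left)
  finally show "(\<integral>z. h z \<partial>lborel) = (\<integral>z. indicator H z * (h z + h (reflect e l z)) \<partial>lborel)" .
qed

text \<open>Supplies both kernel comparisons: seen from \<open>x\<close>, the mirror image of
  \<open>z\<close> stays clear of the singularity, and it is farther away than \<open>z\<close>
  itself. The first bound projects onto \<open>e\<close>, the mirror image lying beyond the
  plane.\<close>

lemma reflect_far:
  assumes unit: "norm e = 1" and xz: "x \<bullet> e < l" "z \<bullet> e < l"
  shows "l - x \<bullet> e \<le> norm (x - reflect e l z)" "norm (x - z) < norm (x - reflect e l z)"
proof -
  have "l - x \<bullet> e \<le> - ((x - reflect e l z) \<bullet> e)"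
    using xz by (simp add: inner_diff_left reflect_inner[OF unit])
  also have "\<dots> \<le> norm (x - reflect e l z)"
    using Cauchy_Schwarz_ineq2[of "x - reflect e l z" e] unit by simp
  finally show "l - x \<bullet> e \<le> norm (x - reflect e l z)" .
  have "0 < 4 * (l - x \<bullet> e) * (l - z \<bullet> e)"
    using xz by (intro mult_pos_pos) auto
  then have "(norm (x - z))\<^sup>2 < (norm (x - reflect e l z))\<^sup>2"
    using norm_reflect_diff_sq[OF unit, of x l z] by linarith
  then show "norm (x - z) < norm (x - reflect e l z)"
    by (rule power2_less_imp_less) simp
qed

section \<open>The equation, its kernel and the truncated integrals\<close>

locale dirichlet_solution =
  fixes u :: "real ^ 'n \<Rightarrow> real" and G f :: "real \<Rightarrow> real" and \<alpha> C c0 L :: real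
  assumes alpha_pos: "0 < \<alpha>" and C_pos: "0 < C" and c0_pos: "0 < c0"
    and G_cont: "continuous_on UNIV G"
    and G_growth: "\<And>s t. s \<le> t \<Longrightarrow> c0 * (t - s) \<le> G t - G s"
    and f_lipschitz: "\<And>s t. \<bar>f s - f t\<bar> \<le> L * \<bar>s - t\<bar>"
    and u_cont: "continuous_on UNIV u"
    and u_pos: "\<And>x. x \<in> ball 0 1 \<Longrightarrow> 0 < u x"
    and u_outside: "\<And>x. x \<notin> ball 0 1 \<Longrightarrow> u x = 0"
    and F_ex: "\<And>x. x \<in> ball 0 1 \<Longrightarrow> F_exists \<alpha> G u x"
    and u_eq: "\<And>x. x \<in> ball 0 1 \<Longrightarrow> F_op C \<alpha> G u x = f (u x)"
begin

text \<open>At \<open>z = x\<close> the division by zero gives the value 0, not infinity; hence the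
  positive distances asked for in \<open>ker_antimono\<close> and \<open>ker_ge\<close>.\<close>

definition ker :: "real ^ 'n \<Rightarrow> real ^ 'n \<Rightarrow> real" where
  "ker x z = 1 / norm (x - z) powr (real CARD('n) + \<alpha>)"

lemma ker_nonneg: "0 \<le> ker x z"
  by (simp add: ker_def)

lemma ker_antimono: "0 < norm (x - z) \<Longrightarrow> norm (x - z) \<le> norm (x - y) \<Longrightarrow> ker x y \<le> ker x z"
  unfolding ker_def using alpha_pos by (intro divide_left_mono powr_mono2 mult_pos_pos) auto

lemma ker_le: "0 < d \<Longrightarrow> d \<le> norm (x - y) \<Longrightarrow> ker x y \<le> 1 / d powr (real CARD('n) + \<alpha>)"
  unfolding ker_def using alpha_pos by (intro divide_left_mono powr_mono2 mult_pos_pos) auto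

lemma ker_ge: "0 < norm (x - y) \<Longrightarrow> norm (x - y) \<le> d \<Longrightarrow> 1 / d powr (real CARD('n) + \<alpha>) \<le> ker x y"
  unfolding ker_def using alpha_pos by (intro divide_left_mono powr_mono2 mult_pos_pos) auto

lemma F_integrand_ker: "F_integrand \<alpha> G u x z = G (u x - u z) * ker x z"
  by (simp add: F_integrand_def ker_def)

lemma u_measurable [measurable]: "u \<in> borel_measurable borel"
  by (rule borel_measurable_continuous_onI[OF u_cont])

lemma G_measurable [measurable]: "G \<in> borel_measurable borel"
  by (rule borel_measurable_continuous_onI[OF G_cont])

lemma ker_measurable [measurable]: "ker x \<in> borel_measurable borel"
  unfolding ker_def by measurable

text \<open>The integrands are Borel, so \<open>lebesgue\<close> can be replaced by
  \<open>lborel\<close>, the measure of the reflection formulas.\<close>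

lemma
  assumes "x \<in> ball 0 1" "0 < \<epsilon>"
  shows integrable_truncated:
      "integrable lborel (\<lambda>z. indicator (- ball x \<epsilon>) z * (G (u x - u z) * ker x z))" (is "integrable _ ?h")
    and F_truncated_eq:
      "F_truncated \<alpha> G u x \<epsilon> = (\<integral>z. indicator (- ball x \<epsilon>) z * (G (u x - u z) * ker x z) \<partial>lborel)"
proof -
  have [measurable]: "- ball x \<epsilon> \<in> sets borel"
    by (intro borel_closed) (simp add: closed_Compl)
  have m: "?h \<in> borel_measurable lborel"
    by measurable
  show "integrable lborel ?h"
    using F_ex[OF assms(1)] assms(2) integrable_completion[OF m]
    by (simp add: F_exists_def set_integrable_def F_integrand_ker)
  show "F_truncated \<alpha> G u x \<epsilon> = integral\<^sup>L lborel ?h"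
    using integral_completion[OF m]
    by (simp add: F_truncated_def set_lebesgue_integral_def F_integrand_ker)
qed

text \<open>\<open>F_exists\<close> supplies a limit, and uniqueness of limits identifies it with
  the \<open>Lim\<close> inside \<open>F_op\<close>.\<close>

lemma F_truncated_tendsto:
  assumes "x \<in> ball 0 1"
  shows "(F_truncated \<alpha> G u x \<longlongrightarrow> f (u x) / C) (at_right 0)"
proof -
  obtain l where l: "(F_truncated \<alpha> G u x \<longlongrightarrow> l) (at_right 0)"
    using F_ex[OF assms] by (auto simp: F_exists_def)
  then have "Lim (at_right 0) (F_truncated \<alpha> G u x) = l"
    by (intro tendsto_Lim) simp_all
  then have "l = f (u x) / C"
    using u_eq[OF assms] C_pos by (simp add: F_op_def field_simps)
  with l show ?thesis
    by simp
qed

text \<open>Crossing a plane with \<open>l\<close> at most 0 from the left never increases the norm.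
  This makes the equation available at the mirror image of \<open>x\<close> as well.\<close>

lemma reflect_in_ball:
  assumes "norm e = 1" "x \<in> ball 0 1" "x \<bullet> e < l" "l \<le> 0"
  shows "reflect e l x \<in> ball 0 1"
proof -
  have "l * (l - x \<bullet> e) \<le> 0"
    using assms by (intro mult_nonpos_nonneg) auto
  then have "(norm (reflect e l x))\<^sup>2 \<le> (norm x)\<^sup>2"
    using norm_reflect_sq[OF assms(1), of l x] by simp
  then have "norm (reflect e l x) \<le> norm x"
    by (simp add: power_mono_iff)
  then show ?thesis
    using assms(2) by simp
qed

section \<open>The integral inequality at a minimum of the gap\<close>

definition gap :: "real ^ 'n \<Rightarrow> real \<Rightarrow> real ^ 'n \<Rightarrow> real" where
  "gap e l x = u (reflect e l x) - u x"

text \<open>Folding the integral over the plane pairs \<open>z\<close> with its reflection; the two parts of the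
  bound come from the difference of the two kernels and from the reflected kernel alone.\<close>
lemma reflected_equation_le:
  assumes unit: "norm e = 1" and x: "x \<in> ball 0 1" "x \<bullet> e < l" and l: "l \<le> 0"
    and neg: "gap e l x \<le> 0"
    and least: "\<And>z. z \<bullet> e < l \<Longrightarrow> gap e l x \<le> gap e l z"
    and S: "ball z0 r \<subseteq> {z. z \<bullet> e < l} - ball x d" and "0 < d" and "0 \<le> m"
    and m: "\<And>z. z \<in> ball z0 r \<Longrightarrow> m \<le> c0 * ((ker x z - ker x (reflect e l z)) * (gap e l z - gap e l x)
        - 2 * ker x (reflect e l z) * gap e l x)"
  shows "f (u (reflect e l x)) - f (u x) \<le> - (C * m * measure lborel (ball z0 r))"
proof -
  define R where "R = reflect e l"
  define H where "H = {z::real^'n. z \<bullet> e < l}"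
  define \<delta> where "\<delta> = l - x \<bullet> e"
  define A where "A z = G (u (R x) - u (R z)) - G (u x - u z)" for z
  define h where "h \<epsilon> z = indicator (- ball x \<epsilon>) z * (A z * ker x z)" for \<epsilon> z
  have \<delta>: "0 < \<delta>" using x by (simp add: \<delta>_def)
  have RR [simp]: "R (R z) = z" for z
    by (simp add: R_def reflect_reflect[OF unit])
  have Rx: "R x \<in> ball 0 1"
    unfolding R_def by (rule reflect_in_ball) fact+
  have norm_R: "norm (R x - R z) = norm (x - z)" for z
    unfolding R_def by (rule norm_reflect_reflect[OF unit])
  have [measurable]: "R \<in> borel_measurable borel"
    unfolding R_def by measurable
  have [measurable]: "H \<in> sets borel"
    unfolding H_def by measurable
  have ball_meas [measurable]: "- ball y \<epsilon> \<in> sets borel" for y :: "real^'n" and \<epsilon>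
    by (intro borel_closed) (simp add: closed_Compl)
  note borel_open[OF open_ball, measurable]

  have diff: "F_truncated \<alpha> G u (R x) \<epsilon> - F_truncated \<alpha> G u x \<epsilon> = (\<integral>z. h \<epsilon> z \<partial>lborel)"
    and h_int: "integrable lborel (h \<epsilon>)" if "0 < \<epsilon>" for \<epsilon>
  proof -
    \<comment> \<open>As \<open>R\<close> is an isometry, substituting \<open>R z\<close> for
      \<open>z\<close> in the integral at \<open>R x\<close> moves both the kernel and the removed
      ball back to \<open>x\<close>. The two truncated integrals then have a common domain and
      kernel.\<close>
    let ?g = "\<lambda>z. indicator (- ball (R x) \<epsilon>) z * (G (u (R x) - u z) * ker (R x) z)"
    let ?g' = "\<lambda>z. indicator (- ball x \<epsilon>) z * (G (u (R x) - u (R z)) * ker x z)"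
    have g: "?g (R z) = ?g' z" for z
      by (simp add: ker_def norm_R dist_norm indicator_def)
    have g_meas: "?g \<in> borel_measurable borel"
      by measurable
    have int': "integrable lborel ?g'"
      using integrable_truncated[OF Rx that] integrable_reflect[OF unit g_meas, of l, folded R_def]
      unfolding g by simp
    have trunc': "F_truncated \<alpha> G u (R x) \<epsilon> = (\<integral>z. ?g' z \<partial>lborel)"
      using F_truncated_eq[OF Rx that] integral_reflect[OF unit g_meas, of l, folded R_def]
      unfolding g by simp
    have h: "h \<epsilon> z = ?g' z - indicator (- ball x \<epsilon>) z * (G (u x - u z) * ker x z)" for z
      by (simp add: h_def A_def algebra_simps)
    show "F_truncated \<alpha> G u (R x) \<epsilon> - F_truncated \<alpha> G u x \<epsilon> = (\<integral>z. h \<epsilon> z \<partial>lborel)"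
      unfolding h trunc' F_truncated_eq[OF x(1) that]
      by (rule Bochner_Integration.integral_diff[symmetric, OF int' integrable_truncated[OF x(1) that]])
    show "integrable lborel (h \<epsilon>)"
      unfolding h[abs_def] by (rule Bochner_Integration.integrable_diff[OF int' integrable_truncated[OF x(1) that]])
  qed

  \<comment> \<open>For \<open>z\<close> in \<open>ball x \<epsilon>\<close> the truncation removes
    \<open>z\<close> but not its mirror image. That remainder is at most \<open>M'\<close>, since
    the mirror image is at least \<open>\<delta>\<close> away from \<open>x\<close>, and its
    integral vanishes with the volume of the ball.\<close>
  have "continuous_on (cball x 1) (\<lambda>z. A (R z))"
    unfolding A_def RR unfolding R_def
    by (intro continuous_intros continuous_on_compose2[OF G_cont] continuous_on_compose2[OF u_cont]) auto
  then have "bounded ((\<lambda>z. A (R z)) ` cball x 1)"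
    by (intro compact_imp_bounded compact_continuous_image) auto
  then obtain M where M: "0 < M" "\<And>z. z \<in> cball x 1 \<Longrightarrow> norm (A (R z)) \<le> M"
    unfolding bounded_pos by auto
  define M' where "M' = M / \<delta> powr (real CARD('n) + \<alpha>)"

  have far: "\<delta> \<le> norm (x - R z)" "norm (x - z) < norm (x - R z)" if "z \<in> H" for z
    using that x(2) reflect_far[OF unit, of x l z] by (auto simp: H_def R_def \<delta>_def)

  have fold_le: "indicator H z * (h \<epsilon> z + h \<epsilon> (R z)) \<le> M' * indicator (ball x \<epsilon>) z - m * indicator (ball z0 r) z"
    if \<epsilon>: "0 < \<epsilon>" "\<epsilon> < \<delta>" "\<epsilon> < 1" "\<epsilon> < d" for \<epsilon> z
  proof (cases "z \<in> H")
    case False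
    then have "z \<notin> ball z0 r"
      using S by (auto simp: H_def)
    then show ?thesis
      using False M(1) \<delta> by (simp add: M'_def)
  next
    case zH: True
    have hR: "h \<epsilon> (R z) = A (R z) * ker x (R z)"
      using far[OF zH] \<epsilon> by (simp add: h_def dist_norm)
    show ?thesis
    proof (cases "z \<in> ball x \<epsilon>")
      case True
      then have "z \<notin> ball z0 r"
        using S \<epsilon> by auto
      have "A (R z) * ker x (R z) \<le> M * (1 / \<delta> powr (real CARD('n) + \<alpha>))"
        using M(1) M(2)[of z] True \<epsilon> ker_nonneg ker_le[OF \<delta> far(1)[OF zH]]
        by (intro mult_mono) auto
      moreover have "h \<epsilon> z = 0"
        using True by (simp add: h_def)
      ultimately show ?thesis
        using True \<open>z \<notin> ball z0 r\<close> zH hR by (simp add: M'_def)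
    next
      case False
      let ?k = "ker x z" and ?k' = "ker x (R z)" and ?w = "gap e l x" and ?v = "gap e l z"
      have w: "?w = u (R x) - u x" "?v = u (R z) - u z"
        by (simp_all add: gap_def R_def)
      have wv: "?w \<le> ?v"
        using least zH by (simp add: H_def)
      have kk: "?k' \<le> ?k"
        using False \<epsilon> far(2)[OF zH] by (intro ker_antimono) (auto simp: dist_norm)
      \<comment> \<open>The arguments of \<open>G\<close> in \<open>A z\<close> differ by
        \<open>?w - ?v\<close>. In \<open>A z + A (R z)\<close> the four terms are regrouped into
        two differences whose arguments each differ by \<open>?w\<close>. The sum is then split with
        the nonnegative weights \<open>?k - ?k'\<close> and \<open>?k'\<close>.\<close>
      have A1: "A z \<le> - (c0 * (?v - ?w))"
        using G_growth[of "u (R x) - u (R z)" "u x - u z"] wv by (simp add: A_def w algebra_simps)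
      have A2: "A z + A (R z) \<le> 2 * c0 * ?w"
        using G_growth[of "u (R x) - u (R z)" "u x - u (R z)"] G_growth[of "u (R x) - u z" "u x - u z"] neg
        by (simp add: A_def w algebra_simps)
      have "h \<epsilon> z + h \<epsilon> (R z) = (?k - ?k') * A z + ?k' * (A z + A (R z))"
        using False hR by (simp add: h_def algebra_simps)
      also have "\<dots> \<le> (?k - ?k') * (- (c0 * (?v - ?w))) + ?k' * (2 * c0 * ?w)"
        using A1 A2 kk ker_nonneg by (intro add_mono mult_left_mono) auto
      also have "\<dots> = - (c0 * ((?k - ?k') * (?v - ?w) - 2 * ?k' * ?w))" (is "_ = - ?P")
        by (simp add: algebra_simps)
      finally have le: "h \<epsilon> z + h \<epsilon> (R z) \<le> - ?P" .
      have "0 \<le> ?P"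
      proof -
        have "0 \<le> (?k - ?k') * (?v - ?w)"
          using kk wv by simp
        moreover have "2 * ?k' * ?w \<le> 0"
          using neg ker_nonneg by (intro mult_nonneg_nonpos) auto
        ultimately show ?thesis
          using c0_pos by (intro mult_nonneg_nonneg) linarith+
      qed
      moreover have "m \<le> ?P" if "z \<in> ball z0 r"
        using m[OF that] by (simp add: R_def)
      ultimately have "m * indicator (ball z0 r) z \<le> ?P"
        by (auto simp: indicator_def)
      then show ?thesis
        using le False zH by simp
    qed
  qed

  have int_le: "F_truncated \<alpha> G u (R x) \<epsilon> - F_truncated \<alpha> G u x \<epsilon>
      \<le> M' * (\<epsilon> ^ CARD('n) * measure lborel (ball 0 1 :: (real^'n) set)) - m * measure lborel (ball z0 r)"
    if \<epsilon>: "0 < \<epsilon>" "\<epsilon> < \<delta>" "\<epsilon> < 1" "\<epsilon> < d" for \<epsilon>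
  proof -
    have ball_int: "integrable lborel (indicator (ball y s) :: real^'n \<Rightarrow> real)" for y s
      using emeasure_lborel_ball_finite[of y s] by simp
    have "(\<integral>z. h \<epsilon> z \<partial>lborel) = (\<integral>z. indicator H z * (h \<epsilon> z + h \<epsilon> (R z)) \<partial>lborel)"
      using integral_fold_reflect(2)[OF unit h_int[OF \<epsilon>(1)], of l] by (simp add: R_def H_def)
    also have "\<dots> \<le> (\<integral>z. M' * indicator (ball x \<epsilon>) z - m * indicator (ball z0 r) z \<partial>lborel)"
      using integral_fold_reflect(1)[OF unit h_int[OF \<epsilon>(1)], of l] fold_le[OF \<epsilon>] ball_int
      by (intro integral_mono) (auto simp: R_def H_def)
    also have "\<dots> = M' * measure lborel (ball x \<epsilon>) - m * measure lborel (ball z0 r)"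
      using ball_int by (subst Bochner_Integration.integral_diff) auto
    also have "measure lborel (ball x \<epsilon>) = \<epsilon> ^ CARD('n) * measure lborel (ball 0 1 :: (real^'n) set)"
      using content_ball_conv_unit_ball[of \<epsilon> x] \<epsilon>(1) by simp
    finally show ?thesis
      using diff[OF \<epsilon>(1)] by simp
  qed

  \<comment> \<open>The power of 0 is the limit of the error volume; it vanishes because the
    dimension is positive.\<close>
  have "f (u (R x)) / C - f (u x) / C
      \<le> M' * (0 ^ CARD('n) * measure lborel (ball 0 1 :: (real^'n) set)) - m * measure lborel (ball z0 r)"
  proof (rule tendsto_le)
    show "((\<lambda>\<epsilon>. F_truncated \<alpha> G u (R x) \<epsilon> - F_truncated \<alpha> G u x \<epsilon>) \<longlongrightarrow> f (u (R x)) / C - f (u x) / C) (at_right 0)"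
      by (intro tendsto_diff F_truncated_tendsto Rx x)
    show "((\<lambda>\<epsilon>. M' * (\<epsilon> ^ CARD('n) * measure lborel (ball 0 1 :: (real^'n) set)) - m * measure lborel (ball z0 r))
      \<longlongrightarrow> M' * (0 ^ CARD('n) * measure lborel (ball 0 1 :: (real^'n) set)) - m * measure lborel (ball z0 r)) (at_right 0)"
      by (intro tendsto_intros)
    have "\<forall>\<^sub>F \<epsilon> in at_right 0. \<epsilon> \<in> {0<..<min (min \<delta> 1) d}"
      using \<delta> \<open>0 < d\<close> by (intro eventually_at_right_real) simp
    then show "\<forall>\<^sub>F \<epsilon> in at_right 0. F_truncated \<alpha> G u (R x) \<epsilon> - F_truncated \<alpha> G u x \<epsilon>
        \<le> M' * (\<epsilon> ^ CARD('n) * measure lborel (ball 0 1 :: (real^'n) set)) - m * measure lborel (ball z0 r)"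
      by eventually_elim (use int_le in auto)
  qed simp
  then have "(f (u (R x)) - f (u x)) / C \<le> - (m * measure lborel (ball z0 r))"
    by (simp add: diff_divide_distrib power_0_left)
  then show ?thesis
    using C_pos by (simp add: R_def field_simps)
qed

section \<open>Negative minima of the gap and their distance to the plane\<close>

lemma u_nonneg: "0 \<le> u x"
  using u_pos[of x] u_outside[of x] by (cases "x \<in> ball 0 1") auto

lemma continuous_on_gap [continuous_intros]:
  assumes "continuous_on S a" "continuous_on S b"
  shows "continuous_on S (\<lambda>s. gap e (a s) (b s))"
  unfolding gap_def reflect_def
  by (intro continuous_intros assms continuous_on_compose2[OF u_cont]) auto

lemma gap_outside: "x \<notin> ball 0 1 \<Longrightarrow> 0 \<le> gap e l x"
  using u_outside[of x] u_nonneg by (simp add: gap_def)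

text \<open>The gap is nonnegative outside the ball and zero on the plane. A negative minimum over
  the compact set \<open>K\<close> is therefore attained at a point of the ball strictly left of the
  plane, and is a minimum over the whole half-space.\<close>

lemma least_gap:
  assumes y: "y \<bullet> e < l" "gap e l y < 0"
  obtains x where "x \<in> ball 0 1" "x \<bullet> e < l" "gap e l x < 0"
    "\<And>z. z \<bullet> e < l \<Longrightarrow> gap e l x \<le> gap e l z"
proof -
  define K where "K = cball 0 1 \<inter> {x. e \<bullet> x \<le> l}"
  have "compact K"
    unfolding K_def by (intro compact_Int_closed closed_halfspace_le) auto
  moreover have "y \<in> K"
    using y gap_outside[of y e l] by (cases "y \<in> ball 0 1") (auto simp: K_def inner_commute)
  moreover have "continuous_on K (gap e l)"
    by (intro continuous_intros)
  ultimately obtain x where x: "x \<in> K" and min: "\<And>z. z \<in> K \<Longrightarrow> gap e l x \<le> gap e l z"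
    using continuous_attains_inf[of K "gap e l"] by blast
  have neg: "gap e l x < 0"
    using min[OF \<open>y \<in> K\<close>] y(2) by linarith
  show thesis
  proof
    show "x \<in> ball 0 1"
      using gap_outside[of x e l] neg by (cases "x \<in> ball 0 1") auto
    have "x \<bullet> e \<noteq> l"
      using neg by (auto simp: gap_def reflect_def)
    then show "x \<bullet> e < l"
      using x by (simp add: K_def inner_commute)
    show "gap e l x < 0" by fact
    show "gap e l x \<le> gap e l z" if "z \<bullet> e < l" for z
      using min[of z] gap_outside[of z e l] neg that by (cases "z \<in> ball 0 1") (auto simp: K_def inner_commute)
  qed
qed

text \<open>The test ball has radius \<open>\<delta>/2\<close> and its centre \<open>c\<close> is
  \<open>x\<close> moved away from the plane by \<open>\<delta>\<close>. The mirror image of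
  \<open>x\<close> is \<open>3 * \<delta>\<close> from \<open>c\<close>, so the reflected kernel is
  at least \<open>1 / (4 * \<delta>) powr p\<close> on the test ball. Its volume has order
  \<open>\<delta> ^ CARD('n)\<close>, which leaves \<open>\<delta> powr \<alpha>\<close>; the depth
  of the minimum cancels against the Lipschitz bound for \<open>f\<close>.\<close>

lemma distance_to_plane_ge:
  assumes unit: "norm e = 1" and x: "x \<in> ball 0 1" "x \<bullet> e < l" and l: "l \<le> 0"
    and neg: "gap e l x < 0"
    and least: "\<And>z. z \<bullet> e < l \<Longrightarrow> gap e l x \<le> gap e l z"
  shows "2 * C * c0 * measure lborel (ball 0 1 :: (real^'n) set)
    \<le> L * (4 powr (real CARD('n) + \<alpha>) * 2 ^ CARD('n)) * (l - x \<bullet> e) powr \<alpha>"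
proof -
  define p where "p = real CARD('n) + \<alpha>"
  define \<delta> where "\<delta> = l - x \<bullet> e"
  define c where "c = x - \<delta> *\<^sub>R e"
  \<comment> \<open>The depth of the minimum, positive and opposite in sign to the gap.\<close>
  define w where "w = - gap e l x"
  define v where "v = measure lborel (ball 0 1 :: (real^'n) set)"
  define m where "m = 2 * c0 * w / (4 * \<delta>) powr p"
  have \<delta>: "0 < \<delta>" and w: "0 < w"
    using x neg by (simp_all add: \<delta>_def w_def)
  have H: "z \<bullet> e < l" if "z \<in> ball c (\<delta>/2)" for z
  proof -
    have "(z - c) \<bullet> e \<le> norm (z - c)"
      using Cauchy_Schwarz_ineq2[of "z - c" e] unit by simp
    also have "\<dots> < \<delta> / 2"
      using that by (simp add: dist_norm norm_minus_commute)
    finally have "z \<bullet> e < c \<bullet> e + \<delta> / 2"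
      by (simp add: inner_diff_left)
    also have "c \<bullet> e = x \<bullet> e - \<delta>"
      by (simp add: c_def inner_diff_left inner_unit[OF unit])
    finally show ?thesis
      using \<delta> \<delta>_def by linarith
  qed
  have dist_c: "dist x c = \<delta>"
    using \<delta> unit by (simp add: c_def dist_norm)
  have "f (u (reflect e l x)) - f (u x) \<le> - (C * m * measure lborel (ball c (\<delta>/2)))"
  proof (rule reflected_equation_le[OF unit x l _ least])
    show "gap e l x \<le> 0" "0 < \<delta> / 2" "0 \<le> m"
      using neg \<delta> w c0_pos by (auto simp: m_def)
    have "z \<notin> ball x (\<delta>/2)" if "z \<in> ball c (\<delta>/2)" for z
      using that dist_c dist_triangle[of x c z] by (auto simp: dist_commute)
    then show "ball c (\<delta>/2) \<subseteq> {z. z \<bullet> e < l} - ball x (\<delta>/2)"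
      using H by auto
    fix z assume z: "z \<in> ball c (\<delta>/2)"
    let ?k = "ker x z" and ?k' = "ker x (reflect e l z)"
    have "z \<noteq> x"
      using z dist_c \<delta> by (auto simp: dist_commute)
    then have kk: "?k' \<le> ?k"
      using reflect_far(2)[OF unit x(2) H[OF z]] by (intro ker_antimono) auto
    have "norm (x - reflect e l z) = norm (reflect e l x - z)"
      using norm_reflect_commute[OF unit] by simp
    also have "reflect e l x - z = (3 * \<delta>) *\<^sub>R e + (c - z)"
    proof -
      have "(3 * \<delta>) *\<^sub>R e = (2 * \<delta>) *\<^sub>R e + \<delta> *\<^sub>R e"
        by (simp flip: scaleR_add_left)
      then show ?thesis
        by (simp add: c_def reflect_def flip: \<delta>_def)
    qed
    also have "norm \<dots> \<le> 3 * \<delta> + \<delta> / 2"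
      using z \<delta> unit by (intro order.trans[OF norm_triangle_ineq] add_mono) (auto simp: dist_norm)
    finally have "norm (x - reflect e l z) \<le> 4 * \<delta>"
      using \<delta> by simp
    moreover have "0 < norm (x - reflect e l z)"
      using reflect_far(1)[OF unit x(2) H[OF z]] \<delta> unfolding \<delta>_def by linarith
    ultimately have k': "1 / (4 * \<delta>) powr p \<le> ?k'"
      unfolding p_def by (intro ker_ge)
    have "m = c0 * (2 * w * (1 / (4 * \<delta>) powr p))"
      by (simp add: m_def)
    also have "\<dots> \<le> c0 * ((?k - ?k') * (gap e l z - gap e l x) + 2 * w * ?k')"
    proof -
      have "0 \<le> (?k - ?k') * (gap e l z - gap e l x)"
        using kk least[OF H[OF z]] by simp
      moreover have "2 * w * (1 / (4 * \<delta>) powr p) \<le> 2 * w * ?k'"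
        using k' w by (intro mult_left_mono) auto
      ultimately show ?thesis
        using c0_pos by (intro mult_left_mono) auto
    qed
    finally show "m \<le> c0 * ((?k - ?k') * (gap e l z - gap e l x) - 2 * ?k' * gap e l x)"
      by (simp add: w_def algebra_simps)
  qed
  moreover have "- (L * w) \<le> f (u (reflect e l x)) - f (u x)"
    using f_lipschitz[of "u (reflect e l x)" "u x"] neg by (simp add: gap_def w_def)
  ultimately have "C * m * measure lborel (ball c (\<delta>/2)) \<le> L * w"
    by linarith
  moreover have "measure lborel (ball c (\<delta>/2)) = (\<delta>/2) ^ CARD('n) * v"
    using content_ball_conv_unit_ball[of "\<delta>/2" c] \<delta> by (simp add: v_def)
  ultimately have "w * (2 * C * c0 * v * (\<delta>/2) ^ CARD('n) / (4 * \<delta>) powr p) \<le> w * L"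
    by (simp add: m_def mult_ac)
  then have "2 * C * c0 * v * (\<delta>/2) ^ CARD('n) / (4 * \<delta>) powr p \<le> L"
    using w by (rule mult_left_le_imp_le)
  then have "2 * C * c0 * v * (\<delta>/2) ^ CARD('n) \<le> L * (4 * \<delta>) powr p"
    using \<delta> by (simp add: pos_divide_le_eq)
  also have "(4 * \<delta>) powr p = 4 powr p * (\<delta> ^ CARD('n) * \<delta> powr \<alpha>)"
    using \<delta> by (simp add: powr_mult p_def powr_add powr_realpow)
  finally have "\<delta> ^ CARD('n) * (2 * C * c0 * v) \<le> \<delta> ^ CARD('n) * (L * (4 powr p * 2 ^ CARD('n)) * \<delta> powr \<alpha>)"
    by (simp add: power_divide field_simps)
  then show ?thesis
    using \<delta> by (simp add: v_def p_def \<delta>_def)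
qed

section \<open>The strong maximum principle and the planes up to the origin\<close>

lemma gap_pos:
  assumes unit: "norm e = 1" and l: "- 1 < l" "l < 0"
    and nonneg: "\<And>z. z \<bullet> e < l \<Longrightarrow> 0 \<le> gap e l z"
    and x: "x \<in> ball 0 1" "x \<bullet> e < l"
  shows "0 < gap e l x"
proof (rule ccontr)
  assume "\<not> 0 < gap e l x"
  then have zero: "gap e l x = 0"
    using nonneg[OF x(2)] by simp
  define P where "P z = c0 * ((ker x z - ker x (reflect e l z)) * gap e l z)" for z
  \<comment> \<open>The point \<open>- e\<close> lies on the unit sphere, where \<open>u\<close>
    vanishes, while its mirror image is inside the ball because \<open>l\<close> lies strictly
    between -1 and 0. So the gap is positive at \<open>- e\<close>, and by continuity
    \<open>P\<close> stays above half its value on a small ball there.\<close>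
  have e_H: "(- e) \<bullet> e < l"
    using l by (simp add: inner_unit[OF unit])
  have "reflect e l (- e) = (2 * l + 1) *\<^sub>R e"
    by (simp add: reflect_def inner_unit[OF unit] scaleR_add_left scaleR_2 distrib_left)
  then have "reflect e l (- e) \<in> ball 0 1"
    using l unit by simp
  then have gap_e: "0 < gap e l (- e)"
    using u_pos u_outside[of "- e"] unit by (simp add: gap_def)
  then have xe: "x \<noteq> - e"
    using zero by auto
  have "isCont P (- e)"
    unfolding P_def ker_def
  proof (intro continuous_intros)
    show "isCont (gap e l) (- e)" "isCont (reflect e l) (- e)"
      by (intro continuous_on_interior[of UNIV] continuous_intros; simp)+
    show "norm (x - - e) \<noteq> 0 " "norm (x - - e) powr (real CARD('n) + \<alpha>) \<noteq> 0"
      using xe by (auto simp: eq_neg_iff_add_eq_0)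
    show "norm (x - reflect e l (- e)) \<noteq> 0" "norm (x - reflect e l (- e)) powr (real CARD('n) + \<alpha>) \<noteq> 0"
      using reflect_far(2)[OF unit x(2) e_H] by auto
  qed
  moreover have "ker x (reflect e l (- e)) < ker x (- e)"
    using reflect_far(2)[OF unit x(2) e_H] xe alpha_pos unfolding ker_def
    by (intro divide_strict_left_mono powr_less_mono2 mult_pos_pos) (auto simp: eq_neg_iff_add_eq_0)
  then have P_e: "0 < P (- e)"
    using gap_e c0_pos by (simp add: P_def)
  ultimately have "\<forall>\<^sub>F z in nhds (- e). P (- e) / 2 < P z"
    using order_tendstoD(1)[of P "P (- e)" "nhds (- e)" "P (- e) / 2"] by (simp add: continuous_at tendsto_nhds_iff)
  \<comment> \<open>Removing half the distance to \<open>x\<close> provides the separation that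
    \<open>reflected_equation_le\<close> asks of its test ball.\<close>
  moreover have "open ({z. z \<bullet> e < l} - cball x (dist x (- e) / 2))"
    by (intro open_Diff) (auto simp: inner_commute[of _ e] open_halfspace_lt)
  then have "\<forall>\<^sub>F z in nhds (- e). z \<in> {z. z \<bullet> e < l} - cball x (dist x (- e) / 2)"
    using e_H xe by (intro eventually_nhds_in_open) auto
  ultimately have "\<forall>\<^sub>F z in nhds (- e). P (- e) / 2 < P z \<and> z \<in> {z. z \<bullet> e < l} - cball x (dist x (- e) / 2)"
    by (rule eventually_conj)
  then obtain r where "0 < r" and r: "\<And>z. z \<in> ball (- e) r \<Longrightarrow>
      P (- e) / 2 < P z \<and> z \<in> {z. z \<bullet> e < l} - cball x (dist x (- e) / 2)"
    unfolding eventually_nhds_metric by (auto simp: dist_commute)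
  have "f (u (reflect e l x)) - f (u x) \<le> - (C * (P (- e) / 2) * measure lborel (ball (- e) r))"
  proof (rule reflected_equation_le[OF unit x])
    show "ball (- e) r \<subseteq> {z. z \<bullet> e < l} - ball x (dist x (- e) / 2)"
      using r by fastforce
    show "P (- e) / 2 \<le> c0 * ((ker x z - ker x (reflect e l z)) * (gap e l z - gap e l x)
        - 2 * ker x (reflect e l z) * gap e l x)" if "z \<in> ball (- e) r" for z
      using r[OF that] zero by (simp add: P_def)
  qed (use l zero nonneg xe P_e in auto)
  moreover have "0 < C * (P (- e) / 2) * measure lborel (ball (- e) r)"
    using C_pos P_e \<open>0 < r\<close> content_ball_pos[of r "- e"] by simp
  moreover have "u (reflect e l x) = u x"
    using zero by (simp add: gap_def)
  ultimately show False
    by simp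
qed

text \<open>The infimum \<open>l0\<close> of the planes with a negative gap is a limit of planes whose minimum points
  keep a fixed distance from the plane; a limit of these points is an interior zero of the gap
  at \<open>l0\<close>, which the strong maximum principle forbids.\<close>
lemma gap_nonneg:
  assumes unit: "norm e = 1" and "l < 0" and "x \<bullet> e < l"
  shows "0 \<le> gap e l x"
proof (rule ccontr)
  assume "\<not> 0 \<le> gap e l x"
  define B where "B = {l. l < 0 \<and> (\<exists>y. y \<bullet> e < l \<and> gap e l y < 0)}"
  define l0 where "l0 = Inf B"
  have l_B: "l \<in> B"
    using assms \<open>\<not> 0 \<le> gap e l x\<close> by (auto simp: B_def)
  have B_least: "\<exists>x. x \<in> ball 0 1 \<and> x \<bullet> e < l \<and> gap e l x < 0 \<and> (\<forall>z. z \<bullet> e < l \<longrightarrow> gap e l x \<le> gap e l z)"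
    if "l \<in> B" for l
    using that least_gap unfolding B_def by (smt (verit, best) mem_Collect_eq)
  have inner_ge: "- 1 \<le> y \<bullet> e" if "y \<in> cball 0 1" for y
    using that Cauchy_Schwarz_ineq2[of y e] unit by simp
  have bdd: "bdd_below B"
  proof (rule bdd_belowI)
    fix l assume "l \<in> B"
    then obtain y where "y \<in> ball 0 1" "y \<bullet> e < l"
      using B_least by blast
    then show "- 1 \<le> l"
      using inner_ge[of y] by (simp add: less_imp_le)
  qed
  have l0_neg: "l0 < 0"
    using cInf_lower[OF l_B bdd] assms(2) by (simp add: l0_def)

  \<comment> \<open>A negative gap at a fixed point persists for slightly smaller \<open>l\<close>,
    which would then belong to \<open>B\<close> although they lie below its infimum.\<close>
  have nonneg0: "0 \<le> gap e l0 y" if y: "y \<bullet> e < l0" for y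
  proof (rule ccontr)
    assume "\<not> 0 \<le> gap e l0 y"
    have "((\<lambda>l. gap e l y) \<longlongrightarrow> gap e l0 y) (at_left l0)"
    proof -
      have "continuous_on UNIV (\<lambda>l. gap e l y)"
        by (intro continuous_intros)
      then have "isCont (\<lambda>l. gap e l y) l0"
        by (simp add: continuous_on_eq_continuous_at)
      then show ?thesis
        by (auto simp: isCont_def intro: tendsto_within_subset)
    qed
    then have "\<forall>\<^sub>F l in at_left l0. gap e l y < 0"
      using \<open>\<not> 0 \<le> gap e l0 y\<close> by (intro order_tendstoD) auto
    moreover have "\<forall>\<^sub>F l in at_left l0. l \<in> {y \<bullet> e<..<l0}"
      by (rule eventually_at_left_real[OF y])
    ultimately have "\<forall>\<^sub>F l in at_left l0. l \<in> B \<and> l < l0"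
      by eventually_elim (use l0_neg in \<open>auto simp: B_def\<close>)
    then obtain l where "l \<in> B" "l < l0"
      using eventually_happens'[OF trivial_limit_at_left_real] by blast
    then show False
      using cInf_lower[OF _ bdd, of l] by (simp add: l0_def)
  qed

  have "\<exists>l. l \<in> B \<and> l < l0 + inverse (real (Suc k))" for k
    using cInf_lessD[of B "l0 + inverse (real (Suc k))"] l_B by (auto simp: l0_def)
  then obtain l where l: "\<And>k. l k \<in> B" "\<And>k. l k < l0 + inverse (real (Suc k))"
    by metis
  have l0_le: "l0 \<le> l k" for k
    using cInf_lower[OF l(1) bdd] by (simp add: l0_def)
  have l_lim: "l \<longlonglongrightarrow> l0"
  proof (rule tendsto_sandwich[OF _ _ tendsto_const])
    show "(\<lambda>k. l0 + inverse (real (Suc k))) \<longlonglongrightarrow> l0"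
      using tendsto_add[OF tendsto_const[of l0] LIMSEQ_inverse_real_of_nat] by simp
  qed (use l0_le l(2) in \<open>auto intro!: always_eventually less_imp_le\<close>)
  obtain y where y: "\<And>k. y k \<in> ball 0 1" "\<And>k. y k \<bullet> e < l k" "\<And>k. gap e (l k) (y k) < 0"
    "\<And>k z. z \<bullet> e < l k \<Longrightarrow> gap e (l k) (y k) \<le> gap e (l k) z"
    using B_least[OF l(1)] by metis
  have "\<forall>k. y k \<in> cball 0 1"
    using y(1) by (auto simp: less_imp_le)
  then obtain y0 s where y0: "y0 \<in> cball 0 1" and "strict_mono s" and "(y \<circ> s) \<longlonglongrightarrow> y0"
    using compact_cball[of "0::real^'n" 1] unfolding compact_def by meson
  then have y_lim: "(\<lambda>k. y (s k)) \<longlonglongrightarrow> y0" and ls_lim: "(\<lambda>k. l (s k)) \<longlonglongrightarrow> l0"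
    using LIMSEQ_subseq_LIMSEQ[OF l_lim \<open>strict_mono s\<close>] by (simp_all add: o_def)

  define a where "a = 2 * C * c0 * measure lborel (ball 0 1 :: (real^'n) set)"
  define b where "b = L * (4 powr (real CARD('n) + \<alpha>) * 2 ^ CARD('n))"
  \<comment> \<open>The distance bound survives the limit. As \<open>a\<close> is positive and
    \<open>0 powr \<alpha> = 0\<close>, the limit point cannot lie on the plane.\<close>
  have "a \<le> b * (l0 - y0 \<bullet> e) powr \<alpha>"
  proof (rule tendsto_lowerbound)
    show "((\<lambda>k. b * (l (s k) - y (s k) \<bullet> e) powr \<alpha>) \<longlongrightarrow> b * (l0 - y0 \<bullet> e) powr \<alpha>) sequentially"
      using alpha_pos y(2) by (intro tendsto_intros tendsto_powr' y_lim ls_lim)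
        (auto intro!: always_eventually less_imp_le)
    have "a \<le> b * (l (s k) - y (s k) \<bullet> e) powr \<alpha>" for k
      unfolding a_def b_def using y l(1)[of "s k"]
      by (intro distance_to_plane_ge[OF unit]) (auto simp: B_def)
    then show "\<forall>\<^sub>F k in sequentially. a \<le> b * (l (s k) - y (s k) \<bullet> e) powr \<alpha>"
      by simp
  qed simp
  moreover have "0 < a"
    using C_pos c0_pos content_ball_pos[of 1 "0::real^'n"] by (simp add: a_def)
  ultimately have "l0 - y0 \<bullet> e \<noteq> 0"
    by auto
  moreover have "y0 \<bullet> e \<le> l0"
    by (rule LIMSEQ_le[OF tendsto_inner[OF y_lim tendsto_const] ls_lim]) (use y(2) in \<open>auto intro: less_imp_le\<close>)
  ultimately have y0_H: "y0 \<bullet> e < l0"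
    by simp

  have "continuous_on UNIV (\<lambda>q. gap e (fst q) (snd q))"
    by (intro continuous_intros)
  then have "(\<lambda>k. gap e (fst (l (s k), y (s k))) (snd (l (s k), y (s k)))) \<longlonglongrightarrow> gap e (fst (l0, y0)) (snd (l0, y0))"
    by (rule continuous_on_tendsto_compose[OF _ tendsto_Pair[OF ls_lim y_lim]]) auto
  then have "(\<lambda>k. gap e (l (s k)) (y (s k))) \<longlonglongrightarrow> gap e l0 y0"
    by simp
  then have "gap e l0 y0 \<le> 0"
    by (rule tendsto_upperbound) (use y(3) in \<open>auto intro!: always_eventually less_imp_le\<close>)
  \<comment> \<open>The limit point may have reached the unit sphere, where \<open>gap_pos\<close>
    does not apply; there \<open>u\<close> is 0 and the mirror image falls inside the ball.\<close>
  moreover have "0 < gap e l0 y0"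
  proof (cases "y0 \<in> ball 0 1")
    case True
    then show ?thesis
      using gap_pos[OF unit _ l0_neg nonneg0 True y0_H] inner_ge[OF y0] y0_H by simp
  next
    case False
    then have "norm y0 = 1"
      using y0 by simp
    moreover have "4 * l0 * (l0 - y0 \<bullet> e) < 0"
      using l0_neg y0_H mult_neg_pos[of "4 * l0" "l0 - y0 \<bullet> e"] by simp
    ultimately have "(norm (reflect e l0 y0))\<^sup>2 < 1"
      using norm_reflect_sq[OF unit, of l0 y0] by simp
    then have "reflect e l0 y0 \<in> ball 0 1"
      by (simp add: power_less_one_iff abs_square_less_1)
    then show ?thesis
      using u_pos u_outside[OF False] by (simp add: gap_def)
  qed
  ultimately show False
    by simp
qed

section \<open>Radial symmetry and strict monotonicity\<close>

lemma le_reflect_0: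
  assumes unit: "norm e = 1" and x: "x \<bullet> e < 0"
  shows "u x \<le> u (reflect e 0 x)"
proof -
  have "continuous_on UNIV (\<lambda>l. gap e l x)"
    by (intro continuous_intros)
  then have "isCont (\<lambda>l. gap e l x) 0"
    by (simp add: continuous_on_eq_continuous_at)
  then have "((\<lambda>l. gap e l x) \<longlongrightarrow> gap e 0 x) (at_left 0)"
    by (auto simp: isCont_def intro: tendsto_within_subset)
  moreover have "\<forall>\<^sub>F l in at_left 0. 0 \<le> gap e l x"
    using eventually_at_left_real[OF x] by eventually_elim (auto intro: gap_nonneg[OF unit])
  ultimately have "0 \<le> gap e 0 x"
    by (rule tendsto_lowerbound) simp
  then show ?thesis
    by (simp add: gap_def)
qed

text \<open>Through the origin, \<open>e\<close> and \<open>- e\<close> define the same reflection,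
  so the inequality holds on both sides of the plane. Applying it to \<open>x\<close> and to its
  mirror image gives equality.\<close>

lemma reflect_0_invariant:
  assumes unit: "norm e = 1"
  shows "u (reflect e 0 x) = u x"
proof -
  have le: "u x \<le> u (reflect e 0 x)" if "x \<bullet> e \<noteq> 0" for x
  proof (cases "x \<bullet> e < 0")
    case True
    then show ?thesis
      by (rule le_reflect_0[OF unit])
  next
    case False
    then have "u x \<le> u (reflect (- e) 0 x)"
      using unit that by (intro le_reflect_0) auto
    then show ?thesis
      by (simp add: reflect_def)
  qed
  show ?thesis
  proof (cases "x \<bullet> e = 0")
    case True
    then show ?thesis
      by (simp add: reflect_def)
  next
    case False
    then show ?thesis
      using le[of x] le[of "reflect e 0 x"] by (simp add: reflect_inner[OF unit] reflect_reflect[OF unit])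
  qed
qed

text \<open>Two distinct points of equal norm are exchanged by the reflection in their bisecting
  hyperplane, which contains the origin.\<close>

lemma radial:
  assumes "norm x = norm y"
  shows "u x = u y"
proof (cases "x = y")
  case False
  define e where "e = (1 / norm (x - y)) *\<^sub>R (x - y)"
  have "(norm (x - y))\<^sup>2 = 2 * (x \<bullet> (x - y))"
    using assms by (simp add: power2_norm_eq_inner inner_diff_left inner_diff_right inner_commute norm_eq)
  moreover have "2 * (x \<bullet> e) * (1 / norm (x - y)) = 2 * (x \<bullet> (x - y)) / (norm (x - y))\<^sup>2"
    by (simp add: e_def power2_eq_square)
  ultimately have "2 * (x \<bullet> e) * (1 / norm (x - y)) = 1"
    using False by (metis divide_self norm_eq_zero power_eq_0_iff right_minus_eq)
  moreover have "(2 * (x \<bullet> e)) *\<^sub>R e = (2 * (x \<bullet> e) * (1 / norm (x - y))) *\<^sub>R (x - y)"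
    by (simp add: e_def)
  ultimately have "(2 * (x \<bullet> e)) *\<^sub>R e = x - y"
    by (metis scaleR_one)
  then have "reflect e 0 x = y"
    by (simp add: reflect_def)
  moreover have "norm e = 1"
    using False by (simp add: e_def)
  ultimately show ?thesis
    using reflect_0_invariant[of e x] by simp
qed simp

lemma radial_decreasing_u: "radial_decreasing u"
  unfolding radial_decreasing_def
proof (intro exI conjI allI)
  \<comment> \<open>Any unit vector would do; \<open>undefined\<close> just picks some
    coordinate.\<close>
  define e :: "real^'n" where "e = axis undefined 1"
  have unit: "norm e = 1"
    by (simp add: e_def)
  show "u x = u (norm x *\<^sub>R e)" for x
    using unit by (intro radial) simp
  show "strict_antimono_on {0..<1} (\<lambda>r. u (r *\<^sub>R e))"
  proof (rule monotone_onI)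
    fix r s :: real
    assume rs: "r \<in> {0..<1}" "s \<in> {0..<1}" "r < s"
    \<comment> \<open>The plane halfway between the points at \<open>- s\<close> and
      \<open>- r\<close> along \<open>e\<close>, so that the reflection takes the first to the
      second; \<open>gap_pos\<close> then gives strictness.\<close>
    define l where "l = - ((r + s) / 2)"
    have l: "- 1 < l" "l < 0"
      using rs by (auto simp: l_def)
    have gap: "0 < gap e l ((- s) *\<^sub>R e)"
      using rs by (intro gap_pos[OF unit l gap_nonneg[OF unit l(2)]]) (auto simp: unit inner_unit[OF unit] l_def)
    have "reflect e l ((- s) *\<^sub>R e) = (- s + 2 * (l + s)) *\<^sub>R e"
      by (simp only: reflect_def inner_scaleR_left inner_unit[OF unit] scaleR_add_left) simp
    moreover have "- s + 2 * (l + s) = - r"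
      by (simp add: l_def field_simps)
    ultimately have "reflect e l ((- s) *\<^sub>R e) = (- r) *\<^sub>R e"
      by simp
    with gap have "u ((- s) *\<^sub>R e) < u ((- r) *\<^sub>R e)"
      by (simp add: gap_def)
    then show "u (s *\<^sub>R e) < u (r *\<^sub>R e)"
      using radial[of "(- s) *\<^sub>R e" "s *\<^sub>R e"] radial[of "(- r) *\<^sub>R e" "r *\<^sub>R e"] by simp
  qed
qed

end

(* Continuity of u up to the boundary is part of the notion of a (classical) solution of
   the Dirichlet problem; u(x) = (1 - |x|^2)^(alpha/2 - 1) on the ball, 0 outside, satisfies
   all other hypotheses with G(t) = t and f = 0, and is increasing in |x|. *)
theorem theorem4:
  fixes u :: "real ^ 'n \<Rightarrow> real"
    and G G' f :: "real \<Rightarrow> real"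
    and \<alpha> C c0 :: real
  assumes alpha: "0 < \<alpha>" "\<alpha> < 2"
    and C_pos: "C > 0"
    and G_C1: "\<And>t. (G has_real_derivative G' t) (at t)" "continuous_on UNIV G'"
    and G_zero: "G 0 = 0"
    and G'_lower: "c0 > 0" "\<And>t. G' t \<ge> c0"
    and f_lipschitz: "\<exists>L. L-lipschitz_on UNIV f"
    and u_space: "u \<in> L_space \<alpha> \<inter> C11_loc (ball 0 1)"
    and u_continuous: "continuous_on (cball 0 1) u"
    and u_pos: "\<And>x. x \<in> ball 0 1 \<Longrightarrow> u x > 0"
    and F_ex: "\<And>x. x \<in> ball 0 1 \<Longrightarrow> F_exists \<alpha> G u x"
    and u_eq: "\<And>x. x \<in> ball 0 1 \<Longrightarrow> F_op C \<alpha> G u x = f (u x)"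
    and u_outside: "\<And>x. x \<notin> ball 0 1 \<Longrightarrow> u x = 0"
  shows "radial_decreasing u"
proof -
  obtain L where L: "L-lipschitz_on UNIV f"
    using f_lipschitz by blast
  have growth: "c0 * (t - s) \<le> G t - G s" if "s \<le> t" for s t
  proof -
    have "G s - c0 * s \<le> G t - c0 * t"
      using that
    proof (rule DERIV_nonneg_imp_nondecreasing)
      show "\<exists>y. ((\<lambda>x. G x - c0 * x) has_real_derivative y) (at x) \<and> 0 \<le> y" for x
        using G'_lower(2)[of x] G_C1(1)[of x]
        by (intro exI[of _ "G' x - c0"]) (auto intro!: derivative_eq_intros)
    qed
    then show ?thesis
      by (simp add: algebra_simps)
  qed
  have G_cont: "continuous_on UNIV G"
    using G_C1(1) DERIV_isCont by (blast intro: continuous_at_imp_continuous_on)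
  \<comment> \<open>The closed ball and the complement of the open ball are closed sets covering the
    space, so continuity on each gives continuity across the sphere.\<close>
  have "continuous_on (- ball 0 1) u"
    by (rule continuous_on_eq[OF continuous_on_const]) (simp add: u_outside)
  then have "continuous_on (cball 0 1 \<union> - ball 0 1) u"
    using u_continuous by (intro continuous_on_closed_Un) (auto simp: closed_Compl)
  moreover have "cball 0 1 \<union> - ball 0 1 = (UNIV :: (real^'n) set)"
    by (auto simp: not_less)
  ultimately have u_cont: "continuous_on UNIV u"
    by simp
  interpret dirichlet_solution u G f \<alpha> C c0 L
  proof
    show "\<bar>f s - f t\<bar> \<le> L * \<bar>s - t\<bar>" for s t
      using lipschitz_onD[OF L, of s t] by (simp add: dist_real_def)
  qed (fact alpha C_pos G'_lower(1) G_cont growth u_cont u_pos u_outside F_ex u_eq)+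
  show ?thesis
    by (rule radial_decreasing_u)
qed

end
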